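(* (High-level programs with separation logic.) For every low-level program $c^L$ and all assertions $\mathcal{P},\mathcal{Q}\subseteq\Sigma^L\times\Sigma^H\times\mathrm{Prog}^H$, the relational Hoare triple $\langle\mathcal{P}\rangle\,c^L\,\langle\mathcal{Q}\rangle$ is valid (in the frame-aware sense) if and only if for all $X,F\subseteq\Sigma^H$ the standard Hoare triple $\{\mathrm{enc}_{(X,F)}(\mathcal{P})\}\,c^L\,\{\mathrm{enc}_{(X,F)}(\mathcal{Q})\}$ is $\forall$-valid.
   Context: $\Sigma^L,\Sigma^H$ are sets of low-level and high-level states and $\mathrm{Prog}^L,\mathrm{Prog}^H$ sets of programs; each program $c$ over $\Sigma$ has a denotational semantics $[\![c]\!]\subseteq\Sigma\times\Sigma$. Assertions are sets; $s\models P$ means $s\in P$. On $\Sigma^H$ there is a partial operation $\sigma_1\uplus\sigma_2$, the disjoint union of states, defined when $\sigma_1,\sigma_2$ are disjoint; any statement mentioning $\sigma\uplus\sigma'$ includes that it is defined. Standard triple: $\{P\}\,c\,\{Q\}$ is $\forall$-valid if for all $\sigma_1\models P$ and $(\sigma_1,\sigma_2)\in[\![c]\!]$, $\sigma_2\models Q$. Configuration refinement: $(\sigma_1,c_1)\hookrightarrow(\sigma_2,c_2)$ iff for all $\sigma_3$, $(\sigma_2,\sigma_3)\in[\![c_2]\!]$ implies $(\sigma_1,\sigma_3)\in[\![c_1]\!]$. Frame-aware relational triple: $\langle\mathcal{P}\rangle\,c^L\,\langle\mathcal{Q}\rangle$ is valid if for every high-level frame $\sigma^H_f\in\Sigma^H$,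 every $(\sigma^L_1,\sigma^H_1,c^H_1)\models\mathcal{P}$ with $\sigma^H_1\uplus\sigma^H_f$ defined, and every $\sigma^L_2$ with $(\sigma^L_1,\sigma^L_2)\in[\![c^L]\!]$, there exist $\sigma^H_2,c^H_2$ such that $\sigma^H_2\uplus\sigma^H_f$ is defined, $(\sigma^H_1\uplus\sigma^H_f,c^H_1)\hookrightarrow(\sigma^H_2\uplus\sigma^H_f,c^H_2)$ and $(\sigma^L_2,\sigma^H_2,c^H_2)\models\mathcal{Q}$. $\sigma\models\mathrm{wlp}(c,X)$ iff for all $\sigma_0$, $(\sigma,\sigma_0)\in[\![c]\!]$ implies $\sigma_0\in X$. Encoding: for $X,F\subseteq\Sigma^H$, $\sigma^L\models\mathrm{enc}_{(X,F)}(\mathcal{P})$ iff there exist $\sigma^H,\sigma^H_f\in\Sigma^H$ and $c^H\in\mathrm{Prog}^H$ with $(\sigma^L,\sigma^H,c^H)\models\mathcal{P}$, $\sigma^H_f\models F$, $\sigma^H\uplus\sigma^H_f$ defined, and $(\sigma^H\uplus\sigma^H_f)\models\mathrm{wlp}(c^H,X)$. *)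

theory Defs
  imports Main
begin

type_synonym ('prog, 'state) semantics = "'prog \<Rightarrow> ('state \<times> 'state) set"

text \<open>
  A partial binary operation on states: \<open>join s t = Some u\<close> means that the
  disjoint union of \<open>s\<close> and \<open>t\<close> is defined and equal to \<open>u\<close>; \<open>join s t = None\<close>
  means that \<open>s\<close> and \<open>t\<close> are not disjoint. No algebraic law is imposed on it.
\<close>
type_synonym 'state partial_op = "'state \<Rightarrow> 'state \<Rightarrow> 'state option"

type_synonym ('l, 'h, 'ph) rel_assertion = "('l \<times> 'h \<times> 'ph) set"

definition hoare_valid ::
  "('prog, 'state) semantics \<Rightarrow> 'state set \<Rightarrow> 'prog \<Rightarrow> 'state set \<Rightarrow> bool"
where
  "hoare_valid sem P c Q \<longleftrightarrow>
     (\<forall>\<sigma>\<^sub>1 \<sigma>\<^sub>2. \<sigma>\<^sub>1 \<in> P \<and> (\<sigma>\<^sub>1, \<sigma>\<^sub>2) \<in> sem c \<longrightarrow> \<sigma>\<^sub>2 \<in> Q)"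

definition config_refines ::
  "('prog, 'state) semantics \<Rightarrow> 'state \<times> 'prog \<Rightarrow> 'state \<times> 'prog \<Rightarrow> bool"
where
  "config_refines sem = (\<lambda>(\<sigma>\<^sub>1, c\<^sub>1) (\<sigma>\<^sub>2, c\<^sub>2).
     \<forall>\<sigma>\<^sub>3. (\<sigma>\<^sub>2, \<sigma>\<^sub>3) \<in> sem c\<^sub>2 \<longrightarrow> (\<sigma>\<^sub>1, \<sigma>\<^sub>3) \<in> sem c\<^sub>1)"

definition wlp ::
  "('prog, 'state) semantics \<Rightarrow> 'prog \<Rightarrow> 'state set \<Rightarrow> 'state set"
where
  "wlp sem c X = {\<sigma>. \<forall>\<sigma>\<^sub>0. (\<sigma>, \<sigma>\<^sub>0) \<in> sem c \<longrightarrow> \<sigma>\<^sub>0 \<in> X}"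

definition rel_triple_valid ::
  "('pl, 'l) semantics \<Rightarrow> ('ph, 'h) semantics \<Rightarrow> 'h partial_op \<Rightarrow>
   ('l, 'h, 'ph) rel_assertion \<Rightarrow> 'pl \<Rightarrow> ('l, 'h, 'ph) rel_assertion \<Rightarrow> bool"
where
  "rel_triple_valid semL semH join P cL Q \<longleftrightarrow>
     (\<forall>\<sigma>f \<sigma>L\<^sub>1 \<sigma>H\<^sub>1 cH\<^sub>1 \<tau>\<^sub>1 \<sigma>L\<^sub>2.
        (\<sigma>L\<^sub>1, \<sigma>H\<^sub>1, cH\<^sub>1) \<in> P \<and> join \<sigma>H\<^sub>1 \<sigma>f = Some \<tau>\<^sub>1 \<and> (\<sigma>L\<^sub>1, \<sigma>L\<^sub>2) \<in> semL cL \<longrightarrow>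
        (\<exists>\<sigma>H\<^sub>2 cH\<^sub>2 \<tau>\<^sub>2. join \<sigma>H\<^sub>2 \<sigma>f = Some \<tau>\<^sub>2 \<and>
           config_refines semH (\<tau>\<^sub>1, cH\<^sub>1) (\<tau>\<^sub>2, cH\<^sub>2) \<and>
           (\<sigma>L\<^sub>2, \<sigma>H\<^sub>2, cH\<^sub>2) \<in> Q))"

definition enc ::
  "('ph, 'h) semantics \<Rightarrow> 'h partial_op \<Rightarrow> 'h set \<Rightarrow> 'h set \<Rightarrow>
   ('l, 'h, 'ph) rel_assertion \<Rightarrow> 'l set"
where
  "enc semH join X F P =
     {\<sigma>L. \<exists>\<sigma>H \<sigma>f cH \<tau>. (\<sigma>L, \<sigma>H, cH) \<in> P \<and> \<sigma>f \<in> F \<and>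
        join \<sigma>H \<sigma>f = Some \<tau> \<and> \<tau> \<in> wlp semH cH X}"

end

(* For the converse direction, the frame is pinned down by F = {f}, and X is chosen as the set of
   outcomes of the initial high-level configuration: the weakest liberal precondition of c with
   respect to that X consists exactly of the states s for which (s, c) is refined from the initial
   configuration. *)
theory Submission
  imports Defs
begin

text \<open>The relational image collects all outcomes of the first configuration, so refinement
  becomes membership in a \<open>wlp\<close>, the form in which \<open>enc\<close> mentions
  high-level programs.\<close>

lemma config_refines_iff_wlp:
  "config_refines sem (\<sigma>\<^sub>1, c\<^sub>1) (\<sigma>\<^sub>2, c\<^sub>2) \<longleftrightarrow> \<sigma>\<^sub>2 \<in> wlp sem c\<^sub>2 (sem c\<^sub>1 `` {\<sigma>\<^sub>1})"
  unfolding config_refines_def wlp_def by auto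

lemma config_refines_refl: "config_refines sem (\<sigma>, c) (\<sigma>, c)"
  unfolding config_refines_def by simp

text \<open>Refinement is inclusion of outcome sets, so any bound \<open>X\<close> on the outcomes
  of the first configuration also bounds those of the second.\<close>

lemma wlp_config_refines:
  assumes "config_refines sem (\<sigma>\<^sub>1, c\<^sub>1) (\<sigma>\<^sub>2, c\<^sub>2)" and "\<sigma>\<^sub>1 \<in> wlp sem c\<^sub>1 X"
  shows "\<sigma>\<^sub>2 \<in> wlp sem c\<^sub>2 X"
  using assms unfolding config_refines_def wlp_def by auto

theorem theorem43:
  fixes semL :: "('pl, 'l) semantics"
    and semH :: "('ph, 'h) semantics"
    and join :: "'h partial_op"
    and cL :: 'pl
    and P Q :: "('l, 'h, 'ph) rel_assertion"
  shows "rel_triple_valid semL semH join P cL Q \<longleftrightarrow>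
    (\<forall>X F. hoare_valid semL (enc semH join X F P) cL (enc semH join X F Q))"
proof
  assume valid: "rel_triple_valid semL semH join P cL Q"
  show "\<forall>X F. hoare_valid semL (enc semH join X F P) cL (enc semH join X F Q)"
    unfolding hoare_valid_def
  proof (intro allI impI, elim conjE)
    fix X F \<sigma>\<^sub>1 \<sigma>\<^sub>2
    assume "\<sigma>\<^sub>1 \<in> enc semH join X F P" and step: "(\<sigma>\<^sub>1, \<sigma>\<^sub>2) \<in> semL cL"
    then obtain \<sigma>H \<sigma>f cH \<tau> where pre: "(\<sigma>\<^sub>1, \<sigma>H, cH) \<in> P" "join \<sigma>H \<sigma>f = Some \<tau>"
      and F: "\<sigma>f \<in> F" and X: "\<tau> \<in> wlp semH cH X"
      unfolding enc_def by blast
    \<comment> \<open>The relational triple is instantiated with the very frame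
      \<open>\<sigma>f\<close> witnessing the encoded precondition; since the triple preserves it,
      \<open>\<sigma>f\<close> in \<open>F\<close> can be reused as the witness for
      \<open>Q\<close>.\<close>
    from valid pre step obtain \<sigma>H' cH' \<tau>' where "join \<sigma>H' \<sigma>f = Some \<tau>'"
      and "config_refines semH (\<tau>, cH) (\<tau>', cH')" and "(\<sigma>\<^sub>2, \<sigma>H', cH') \<in> Q"
      unfolding rel_triple_valid_def by blast
    with F X show "\<sigma>\<^sub>2 \<in> enc semH join X F Q"
      unfolding enc_def by (blast intro: wlp_config_refines)
  qed
next
  assume valid: "\<forall>X F. hoare_valid semL (enc semH join X F P) cL (enc semH join X F Q)"
  show "rel_triple_valid semL semH join P cL Q"
    unfolding rel_triple_valid_def
  proof (intro allI impI, elim conjE)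
    fix \<sigma>f \<sigma>L\<^sub>1 \<sigma>H\<^sub>1 cH\<^sub>1 \<tau>\<^sub>1 \<sigma>L\<^sub>2
    assume pre: "(\<sigma>L\<^sub>1, \<sigma>H\<^sub>1, cH\<^sub>1) \<in> P" "join \<sigma>H\<^sub>1 \<sigma>f = Some \<tau>\<^sub>1"
      and step: "(\<sigma>L\<^sub>1, \<sigma>L\<^sub>2) \<in> semL cL"
    let ?X = "semH cH\<^sub>1 `` {\<tau>\<^sub>1}"
    \<comment> \<open>Via the \<open>wlp\<close> characterization, this is reflexivity of
      refinement.\<close>
    have "\<tau>\<^sub>1 \<in> wlp semH cH\<^sub>1 ?X"
      using config_refines_refl by (simp only: config_refines_iff_wlp)
    with pre have "\<sigma>L\<^sub>1 \<in> enc semH join ?X {\<sigma>f} P"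
      unfolding enc_def by blast
    with valid step have "\<sigma>L\<^sub>2 \<in> enc semH join ?X {\<sigma>f} Q"
      unfolding hoare_valid_def by blast
    \<comment> \<open>The singleton frame set forces the frame hidden in the encoding of
      \<open>Q\<close> to be \<open>\<sigma>f\<close> itself, and membership in the
      \<open>wlp\<close> of \<open>?X\<close> reads back as the required refinement.\<close>
    then show "\<exists>\<sigma>H\<^sub>2 cH\<^sub>2 \<tau>\<^sub>2. join \<sigma>H\<^sub>2 \<sigma>f = Some \<tau>\<^sub>2 \<and>
        config_refines semH (\<tau>\<^sub>1, cH\<^sub>1) (\<tau>\<^sub>2, cH\<^sub>2) \<and> (\<sigma>L\<^sub>2, \<sigma>H\<^sub>2, cH\<^sub>2) \<in> Q"
      unfolding enc_def config_refines_iff_wlp by blast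
  qed
qed

end
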